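(* Let $H$ be a real or complex separable Hilbert space, let $T,S\in\mathcal{C}(H)$ and let $A,B\in\mathcal{B}(H)$ be bounded operators. Then $T+A,\ S+B\in\mathcal{C}(H)$ and $$d_G(T+A,S+B)\leq 2\sqrt{2}\,\sqrt{1+\|A\|^2}\,\sqrt{1+\|B\|^2}\,\bigl(d_G(T,S)+\|A-B\|\bigr).$$
   Context: $\mathcal{C}(H)$ is the set of densely defined closed operators on $H$ and $\mathcal{B}(H)$ the set of bounded operators on $H$. The gap-metric on $\mathcal{C}(H)$ is $d_G(T,S)=\|P_T-P_S\|$, where $P_T,P_S$ are the orthogonal projections in $H\times H$ onto the graphs of $T$ and $S$. *)

theory Defs
  imports "HOL-Analysis.Analysis"
begin

(* A complex inner product space, with inner product linear in the first argument.
   The class extends real_inner: the inherited norm and real structure are those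
   determined by scaleC and cinner through the two compatibility axioms
   scaleR_scaleC and inner_cinner (so that norm x = sqrt (Re (cinner x x))). *)
class complex_inner = real_inner +
  fixes scaleC :: "complex \<Rightarrow> 'a \<Rightarrow> 'a"
    and cinner :: "'a \<Rightarrow> 'a \<Rightarrow> complex"
  assumes scaleC_add_right: "scaleC c (x + y) = scaleC c x + scaleC c y"
    and scaleC_add_left: "scaleC (c + d) x = scaleC c x + scaleC d x"
    and scaleC_scaleC: "scaleC c (scaleC d x) = scaleC (c * d) x"
    and scaleC_one: "scaleC 1 x = x"
    and scaleR_scaleC: "scaleR r x = scaleC (complex_of_real r) x"
    and cinner_commute: "cinner x y = cnj (cinner y x)"
    and cinner_add_left: "cinner (x + y) z = cinner x z + cinner y z"
    and cinner_scaleC_left: "cinner (scaleC c x) y = c * cinner x y"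
    and inner_cinner: "inner x y = Re (cinner x y)"

lemma vector_space_scaleC: "vector_space (scaleC :: complex \<Rightarrow> 'a::complex_inner \<Rightarrow> 'a)"
  by standard (simp_all add: scaleC_add_right scaleC_add_left scaleC_scaleC scaleC_one)

instantiation complex :: complex_inner
begin

definition scaleC_complex :: "complex \<Rightarrow> complex \<Rightarrow> complex"
  where "scaleC_complex c x = c * x"

definition cinner_complex :: "complex \<Rightarrow> complex \<Rightarrow> complex"
  where "cinner_complex x y = x * cnj y"

instance
  by standard
    (simp_all add: scaleC_complex_def cinner_complex_def algebra_simps
      scaleR_conv_of_real inner_complex_def)

end

instantiation prod :: (complex_inner, complex_inner) complex_inner
begin

definition scaleC_prod :: "complex \<Rightarrow> 'a \<times> 'b \<Rightarrow> 'a \<times> 'b"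
  where "scaleC_prod c z = (scaleC c (fst z), scaleC c (snd z))"

definition cinner_prod :: "'a \<times> 'b \<Rightarrow> 'a \<times> 'b \<Rightarrow> complex"
  where "cinner_prod z w = cinner (fst z) (fst w) + cinner (snd z) (snd w)"

instance
proof
  fix x y :: "'a \<times> 'b"
  show "cinner x y = cnj (cinner y x)"
    using cinner_commute[of "fst x" "fst y"] cinner_commute[of "snd x" "snd y"]
    by (simp add: cinner_prod_def)
qed (simp_all add: scaleC_prod_def cinner_prod_def scaleC_add_right scaleC_add_left
      scaleC_scaleC scaleC_one scaleR_scaleC cinner_add_left cinner_scaleC_left
      inner_cinner algebra_simps prod_eq_iff inner_prod_def)

end

(* Operators are partial maps, with domain dom T. The parameter scl is the scalar
   multiplication (scaleR or scaleC) with respect to which they are linear. *)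
definition closed_operators ::
    "('k::field \<Rightarrow> 'a \<Rightarrow> 'a) \<Rightarrow> ('a::real_normed_vector \<rightharpoonup> 'a) set"
  where "closed_operators scl = {T.
     module.subspace scl (dom T) \<and>
     (\<forall>x\<in>dom T. \<forall>y\<in>dom T. the (T (x + y)) = the (T x) + the (T y)) \<and>
     (\<forall>c. \<forall>x\<in>dom T. the (T (scl c x)) = scl c (the (T x))) \<and>
     closure (dom T) = UNIV \<and>
     closed (Map.graph T)}"

definition bounded_operators ::
    "('k::field \<Rightarrow> 'a \<Rightarrow> 'a) \<Rightarrow> ('a::real_normed_vector \<Rightarrow> 'a) set"
  where "bounded_operators scl = {A.
     Vector_Spaces.linear scl scl A \<and> (\<exists>K. \<forall>x. norm (A x) \<le> K * norm x)}"

definition operator_plus :: "('a::plus \<rightharpoonup> 'a) \<Rightarrow> ('a \<Rightarrow> 'a) \<Rightarrow> ('a \<rightharpoonup> 'a)"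
  where "operator_plus T A = (\<lambda>x. map_option (\<lambda>y. y + A x) (T x))"

(* Orthogonal projection onto a closed subspace M, for the inner product ip. *)
definition orth_proj :: "('a \<Rightarrow> 'a \<Rightarrow> 'k::zero) \<Rightarrow> 'a set \<Rightarrow> 'a::minus \<Rightarrow> 'a"
  where "orth_proj ip M z = (THE p. p \<in> M \<and> (\<forall>m\<in>M. ip (z - p) m = 0))"

(* The inner product ip is the one on the product space 'a * 'a. *)
definition gap_dist ::
    "('a \<times> 'a \<Rightarrow> 'a \<times> 'a \<Rightarrow> 'k::zero) \<Rightarrow>
     ('a::real_normed_vector \<rightharpoonup> 'a) \<Rightarrow> ('a \<rightharpoonup> 'a) \<Rightarrow> real"
  where "gap_dist ip T S =
     onorm (\<lambda>z. orth_proj ip (Map.graph T) z - orth_proj ip (Map.graph S) z)"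

end

theory Submission
  imports Defs
begin

text \<open>
  The graph of T + A is the image of the graph of T under the shear (x, y) \<mapsto> (x, y + A x), whose
  norm is at most sqrt 2 * sqrt (1 + norm A ^ 2), as is that of its inverse. If z lies in the graph
  of T and w is its projection onto the graph of S, then the image of w under the shear by B lies in
  the graph of S + B and differs from the image of z under the shear by A by the B-shear of z - w
  plus (0, (A - B) (fst z)). This bounds the distance of points of one graph to the other graph,
  and for orthogonal projections P, Q onto closed subspaces the norm of P - Q is the larger of the
  norms of (1 - Q) P and (1 - P) Q. In the complex case the projections for the complex inner
  product and for its real part coincide.
\<close>

section \<open>Orthogonal projections in real Hilbert spaces\<close>

text \<open>A minimizing sequence for the distance from \<open>z\<close> to \<open>M\<close> is
  Cauchy by the parallelogram law; its limit lies in \<open>M\<close> and attains the distance, and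
  minimality forces orthogonality.\<close>

lemma closed_subspace_orthogonal_decomp:
  fixes M :: "'a::{real_inner, complete_space} set"
  assumes M: "subspace M" "closed M"
  shows "\<exists>p\<in>M. \<forall>m\<in>M. inner (z - p) m = 0"
proof -
  define d where "d = infdist z M"
  have ne: "M \<noteq> {}" using subspace_0[OF M(1)] by auto
  have d0: "0 \<le> d" unfolding d_def by (rule infdist_nonneg)
  have d_le: "d \<le> norm (z - m)" if "m \<in> M" for m
    using infdist_le[OF that, of z] by (simp add: d_def dist_norm)
  have "\<exists>p\<in>M. norm (z - p) < d + 1 / real (Suc n)" for n
  proof -
    have "infdist z M < d + 1 / real (Suc n)" by (simp add: d_def)
    then show ?thesis
      unfolding infdist_notempty[OF ne] dist_norm
      by (subst (asm) cINF_less_iff) (use ne in \<open>auto intro!: bdd_belowI[of _ 0]\<close>)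
  qed
  then obtain p where pM: "\<And>n. p n \<in> M"
    and pd: "\<And>n. norm (z - p n) < d + 1 / real (Suc n)" by metis
  \<comment> \<open>The midpoint of \<open>p m\<close> and \<open>p n\<close> lies in
    \<open>M\<close>, hence at distance at least \<open>d\<close> from \<open>z\<close>. The
    parallelogram law then bounds the square by 4 (d + e)^2 - 4 d^2 = 8 d e + 4 e^2, and e \<le> 1
    makes this linear in \<open>e\<close>.\<close>
  have close: "(norm (p m - p n))\<^sup>2 \<le> (8 * d + 4) * e"
    if "norm (z - p m) \<le> d + e" "norm (z - p n) \<le> d + e" "0 \<le> e" "e \<le> 1" for m n e
  proof -
    have "(1/2) *\<^sub>R (p m + p n) \<in> M"
      using M(1) pM by (intro subspace_scale subspace_add)
    moreover have "(z - p m) + (z - p n) = 2 *\<^sub>R z - (p m + p n)"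
      by (simp add: scaleR_2)
    then have "(1/2) *\<^sub>R ((z - p m) + (z - p n)) = z - (1/2) *\<^sub>R (p m + p n)"
      by (simp only: scaleR_diff_right) simp
    ultimately have "d \<le> norm ((1/2) *\<^sub>R ((z - p m) + (z - p n)))"
      using d_le by metis
    then have "2 * d \<le> norm ((z - p m) + (z - p n))" by simp
    then have a: "(2 * d)\<^sup>2 \<le> (norm ((z - p m) + (z - p n)))\<^sup>2" using d0 by (intro power_mono) auto
    have b: "(norm (z - p m))\<^sup>2 \<le> (d + e)\<^sup>2" "(norm (z - p n))\<^sup>2 \<le> (d + e)\<^sup>2"
      using that by (auto intro!: power_mono)
    have "(norm ((z - p m) + (z - p n)))\<^sup>2 + (norm (p m - p n))\<^sup>2
        = 2 * (norm (z - p m))\<^sup>2 + 2 * (norm (z - p n))\<^sup>2"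
      by (simp add: power2_norm_eq_inner algebra_simps inner_commute)
    then have "(norm (p m - p n))\<^sup>2 \<le> 4 * (d + e)\<^sup>2 - (2 * d)\<^sup>2" using a b by linarith
    also have "\<dots> = 8 * d * e + 4 * (e * e)" by (simp add: power2_eq_square algebra_simps)
    also have "\<dots> \<le> 8 * d * e + 4 * (e * 1)" using that d0 by (intro add_mono mult_left_mono) auto
    finally show ?thesis by (simp add: algebra_simps)
  qed
  have "Cauchy p"
  proof (rule metric_CauchyI)
    fix e :: real assume e: "0 < e"
    define k where "k = 8 * d + 4"
    have k: "k > 0" using d0 by (simp add: k_def)
    \<comment> \<open>\<open>close\<close> with 1 / (N + 1) as its error bounds the squared
      distances by k / (N + 1), which this choice puts below e^2.\<close>
    obtain N where N: "1 / real (Suc N) < e\<^sup>2 / k"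
      using nat_approx_posE[of "e\<^sup>2 / k"] e k by (auto simp: inverse_eq_divide)
    have *: "norm (z - p n) \<le> d + 1 / real (Suc N)" if "N \<le> n" for n
    proof -
      have "1 / real (Suc n) \<le> 1 / real (Suc N)" using that by (simp add: frac_le)
      then show ?thesis using pd[of n] by linarith
    qed
    have "dist (p m) (p n) < e" if "N \<le> m" "N \<le> n" for m n
    proof -
      have "(norm (p m - p n))\<^sup>2 \<le> k * (1 / real (Suc N))"
        unfolding k_def using that by (intro close *) auto
      also have "\<dots> < e\<^sup>2" using N k by (simp add: field_simps)
      finally show ?thesis using e by (simp add: dist_norm power2_less_imp_less)
    qed
    then show "\<exists>N. \<forall>m\<ge>N. \<forall>n\<ge>N. dist (p m) (p n) < e" by blast
  qed
  then obtain q where q: "p \<longlonglongrightarrow> q"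
    using Cauchy_convergent convergent_def by blast
  have qM: "q \<in> M" using closed_sequentially[OF M(2) _ q] pM by blast
  have lim_d: "(\<lambda>n. d + 1 / real (Suc n)) \<longlonglongrightarrow> d + 0"
    by (intro tendsto_add tendsto_const LIMSEQ_Suc[OF lim_1_over_n])
  have lim_p: "(\<lambda>n. norm (z - p n)) \<longlonglongrightarrow> norm (z - q)" by (intro tendsto_intros q)
  have qd: "norm (z - q) \<le> d"
    using LIMSEQ_le[OF lim_p lim_d] less_imp_le[OF pd] by simp
  \<comment> \<open>If the inner product were positive, a small move from \<open>q\<close> in the
    direction \<open>m\<close> would stay in \<open>M\<close> and come strictly closer to
    \<open>z\<close> than \<open>d\<close>. Applied to both \<open>m\<close> and \<open>- m\<close>,
    this gives orthogonality.\<close>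
  have le0: "inner (z - q) m \<le> 0" if "m \<in> M" for m
  proof (rule ccontr)
    assume "\<not> inner (z - q) m \<le> 0"
    then have "inner (z - q) ((q + m) - q) > 0" by simp
    from closer_point_lemma[OF this] obtain u where u: "dist (q + u *\<^sub>R m) z < dist q z" by auto
    have "q + u *\<^sub>R m \<in> M" using M(1) qM that by (intro subspace_add subspace_scale)
    from d_le[OF this] u qd show False by (simp add: dist_norm norm_minus_commute)
  qed
  have "inner (z - q) m = 0" if "m \<in> M" for m
    using le0[OF that] le0[OF subspace_neg[OF M(1) that]] by simp
  then show ?thesis using qM by blast
qed

lemma orth_proj_eqI:
  fixes M :: "'a::real_inner set"
  assumes M: "subspace M" and p: "p \<in> M" "\<And>m. m \<in> M \<Longrightarrow> inner (z - p) m = 0"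
  shows "orth_proj inner M z = p"
  unfolding orth_proj_def
proof (rule the_equality)
  fix q assume q: "q \<in> M \<and> (\<forall>m\<in>M. inner (z - q) m = 0)"
  \<comment> \<open>Testing both orthogonality conditions on \<open>p - q\<close> itself shows that
    its norm vanishes.\<close>
  have "p - q \<in> M" using M p q by (simp add: subspace_diff)
  then have "inner (z - q) (p - q) - inner (z - p) (p - q) = 0" using p q by simp
  then show "q = p" by (simp flip: inner_diff_left)
qed (use p in auto)

context
  fixes M :: "'a::{real_inner, complete_space} set"
  assumes M: "subspace M" "closed M"
begin

lemma orth_proj_mem: "orth_proj inner M z \<in> M"
  and orth_proj_orthogonal: "m \<in> M \<Longrightarrow> inner (z - orth_proj inner M z) m = 0"
proof -
  obtain p where "p \<in> M" "\<And>m. m \<in> M \<Longrightarrow> inner (z - p) m = 0"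
    using closed_subspace_orthogonal_decomp[OF M] by blast
  with orth_proj_eqI[OF M(1) this]
  show "orth_proj inner M z \<in> M" "m \<in> M \<Longrightarrow> inner (z - orth_proj inner M z) m = 0" by auto
qed

lemma norm_orth_proj_pythagoras:
  "(norm (orth_proj inner M z))\<^sup>2 + (norm (z - orth_proj inner M z))\<^sup>2 = (norm z)\<^sup>2"
  using norm_add_Pythagorean[of "orth_proj inner M z" "z - orth_proj inner M z"]
    orth_proj_orthogonal[OF orth_proj_mem[of z], of z]
  by (simp add: orthogonal_def inner_commute)

lemma norm_orth_proj_le: "norm (orth_proj inner M z) \<le> norm z"
proof (rule power2_le_imp_le)
  show "(norm (orth_proj inner M z))\<^sup>2 \<le> (norm z)\<^sup>2"
    unfolding norm_orth_proj_pythagoras[of z, symmetric] by simp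
qed simp

text \<open>\<open>z - w\<close> splits into the part of \<open>z\<close> orthogonal to
  \<open>M\<close> and a vector of \<open>M\<close>, so Pythagoras applies. Any \<open>w\<close> in
  \<open>M\<close> thus serves as a competitor for bounding the distance to
  \<open>M\<close>.\<close>

lemma norm_diff_orth_proj_le:
  assumes "w \<in> M"
  shows "norm (z - orth_proj inner M z) \<le> norm (z - w)"
proof -
  let ?p = "orth_proj inner M z"
  have "(norm ((z - ?p) + (?p - w)))\<^sup>2 = (norm (z - ?p))\<^sup>2 + (norm (?p - w))\<^sup>2"
    by (intro norm_add_Pythagorean)
      (simp add: orthogonal_def orth_proj_orthogonal orth_proj_mem assms M subspace_diff)
  then have "(norm (z - ?p))\<^sup>2 \<le> (norm (z - w))\<^sup>2" by simp
  then show ?thesis by (rule power2_le_imp_le) simp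
qed

text \<open>Linearity comes from uniqueness: sums and multiples of projections satisfy the
  characterization of the projection of the sum or multiple.\<close>

lemma bounded_linear_orth_proj: "bounded_linear (orth_proj inner M)"
proof (rule bounded_linear_intro[where K = 1])
  fix x y :: 'a and r :: real
  show "orth_proj inner M (x + y) = orth_proj inner M x + orth_proj inner M y"
  proof (rule orth_proj_eqI[OF M(1)])
    fix m assume m: "m \<in> M"
    have "inner (x + y - (orth_proj inner M x + orth_proj inner M y)) m
        = inner (x - orth_proj inner M x) m + inner (y - orth_proj inner M y) m"
      by (simp add: inner_diff_left inner_add_left)
    then show "inner (x + y - (orth_proj inner M x + orth_proj inner M y)) m = 0"
      by (simp only: orth_proj_orthogonal[OF m] add_0)
  qed (intro subspace_add M orth_proj_mem)
  show "orth_proj inner M (r *\<^sub>R x) = r *\<^sub>R orth_proj inner M x"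
  proof (rule orth_proj_eqI[OF M(1)])
    fix m assume m: "m \<in> M"
    have "inner (r *\<^sub>R x - r *\<^sub>R orth_proj inner M x) m = r * inner (x - orth_proj inner M x) m"
      by (simp flip: scaleR_diff_right)
    then show "inner (r *\<^sub>R x - r *\<^sub>R orth_proj inner M x) m = 0"
      by (simp only: orth_proj_orthogonal[OF m] mult_zero_right)
  qed (intro subspace_scale M orth_proj_mem)
  show "norm (orth_proj inner M x) \<le> norm x * 1" using norm_orth_proj_le by simp
qed

end

text \<open>With P and Q the projections onto \<open>M\<close> and \<open>N\<close>, P - Q = P (1 -
  Q) - (1 - P) Q. The two terms have orthogonal ranges and act on orthogonal components of the
  argument, so their bounds combine by Pythagoras to \<open>c\<close> with no extra factor. P (1 -
  Q) is the adjoint of (1 - Q) P, so the two one-sided hypotheses cover both terms.\<close>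

lemma onorm_orth_proj_diff_le:
  fixes M N :: "'a::{real_inner, complete_space} set"
  assumes M: "subspace M" "closed M" and N: "subspace N" "closed N" and "0 \<le> c"
    and MN: "\<And>z. z \<in> M \<Longrightarrow> norm (z - orth_proj inner N z) \<le> c * norm z"
    and NM: "\<And>z. z \<in> N \<Longrightarrow> norm (z - orth_proj inner M z) \<le> c * norm z"
  shows "onorm (\<lambda>z. orth_proj inner M z - orth_proj inner N z) \<le> c"
proof (rule onorm_bound)
  fix x
  let ?P = "orth_proj inner M" and ?Q = "orth_proj inner N"
  define v where "v = ?Q x"
  define u where "u = x - v"
  have v: "v \<in> N" using orth_proj_mem[OF N] by (simp add: v_def)
  have u: "inner u n = 0" if "n \<in> N" for n
    using orth_proj_orthogonal[OF N that, of x] by (simp add: u_def v_def)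
  \<comment> \<open>The adjoint argument in elementary form: the square of the norm of
    \<open>?P u\<close> is the inner product of \<open>?P u\<close> and \<open>u\<close>, and
    subtracting \<open>?Q (?P u)\<close> changes nothing since \<open>u\<close> is orthogonal to
    \<open>N\<close>. Then \<open>MN\<close> applies to \<open>?P u\<close>, and one factor
    cancels.\<close>
  have Pu: "norm (?P u) \<le> c * norm u"
  proof (cases "?P u = 0")
    case False
    have "norm (?P u) * norm (?P u) = inner (?P u) u"
      using orth_proj_orthogonal[OF M orth_proj_mem[OF M], of u u]
      by (simp add: inner_diff_left inner_diff_right inner_commute dot_square_norm power2_eq_square)
    also have "\<dots> = inner (?P u - ?Q (?P u)) u"
      using u[OF orth_proj_mem[OF N], of "?P u"] by (simp add: inner_diff_right inner_commute[of _ u])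
    also have "\<dots> \<le> norm (?P u - ?Q (?P u)) * norm u" by (rule norm_cauchy_schwarz)
    also have "\<dots> \<le> (c * norm (?P u)) * norm u"
      using MN[OF orth_proj_mem[OF M]] by (rule mult_right_mono) simp
    finally have "norm (?P u) * norm (?P u) \<le> norm (?P u) * (c * norm u)"
      by (simp add: mult_ac)
    then show ?thesis using False by simp
  qed (use \<open>0 \<le> c\<close> in simp)
  have "?P x = ?P u + ?P v"
    using linear_add[OF bounded_linear.linear[OF bounded_linear_orth_proj[OF M]], of u v]
    by (simp add: u_def)
  \<comment> \<open>The first summand lies in \<open>M\<close>, the second is orthogonal to
    \<open>M\<close>.\<close>
  then have "?P x - ?Q x = ?P u + (- (v - ?P v))" by (simp add: v_def)
  then have "(norm (?P x - ?Q x))\<^sup>2 = (norm (?P u))\<^sup>2 + (norm (- (v - ?P v)))\<^sup>2"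
    using orth_proj_orthogonal[OF M orth_proj_mem[OF M], of v u]
    by (simp only:) (intro norm_add_Pythagorean, simp add: orthogonal_def inner_commute inner_diff_left inner_diff_right)
  also have "\<dots> \<le> (c * norm u)\<^sup>2 + (c * norm v)\<^sup>2"
    unfolding norm_minus_cancel using Pu NM[OF v] by (intro add_mono power_mono) auto
  also have "\<dots> = (c * norm x)\<^sup>2"
    using norm_orth_proj_pythagoras[OF N, of x]
    by (simp add: power_mult_distrib u_def v_def add.commute flip: distrib_left)
  finally show "norm (?P x - ?Q x) \<le> c * norm x"
    by (rule power2_le_imp_le) (use \<open>0 \<le> c\<close> in simp)
qed fact

lemma onorm_minus_commute:
  fixes f g :: "'a::real_normed_vector \<Rightarrow> 'b::real_normed_vector"
  shows "onorm (\<lambda>x. f x - g x) = onorm (\<lambda>x. g x - f x)"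
  by (simp add: onorm_def norm_minus_commute)

section \<open>Perturbation of graphs by shears\<close>

definition shear :: "('a \<Rightarrow> 'b) \<Rightarrow> 'a \<times> 'b \<Rightarrow> 'a \<times> 'b::plus"
  where "shear A z = (fst z, snd z + A (fst z))"

lemma graph_operator_plus: "Map.graph (operator_plus T A) = shear A ` Map.graph T"
  by (force simp: Map.graph_def operator_plus_def shear_def)

text \<open>The factor \<open>sqrt 2\<close> comes from (s + t)^2 \<le> 2 s^2 + 2 t^2, applied to
  the second component.\<close>

lemma norm_shear_le:
  assumes "bounded_linear A"
  shows "norm (shear A z) \<le> sqrt 2 * sqrt (1 + (onorm A)\<^sup>2) * norm z"
proof (rule power2_le_imp_le)
  obtain x y where z: "z = (x, y)" by fastforce
  have A: "norm (A x) \<le> onorm A * norm x" by (rule onorm[OF assms])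
  have "(norm (y + A x))\<^sup>2 \<le> (norm y + onorm A * norm x)\<^sup>2"
    using norm_triangle_ineq[of y "A x"] A by (intro power_mono) auto
  also have "\<dots> \<le> 2 * (norm y)\<^sup>2 + 2 * (onorm A * norm x)\<^sup>2"
    using sum_squares_bound[of "norm y" "onorm A * norm x"] by (simp add: power2_sum)
  finally have *: "(norm (y + A x))\<^sup>2 \<le> 2 * (norm y)\<^sup>2 + 2 * ((onorm A)\<^sup>2 * (norm x)\<^sup>2)"
    by (simp add: power_mult_distrib)
  \<comment> \<open>These are the terms by which the expanded product exceeds the bound obtained so
    far.\<close>
  have "0 \<le> (onorm A)\<^sup>2 * (norm y)\<^sup>2" "0 \<le> (norm x)\<^sup>2" by auto
  then have "(norm x)\<^sup>2 + (norm (y + A x))\<^sup>2 \<le> 2 * ((1 + (onorm A)\<^sup>2) * ((norm x)\<^sup>2 + (norm y)\<^sup>2))"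
    using * unfolding distrib_left distrib_right mult_1 by linarith
  also have "\<dots> = (sqrt 2 * sqrt (1 + (onorm A)\<^sup>2) * norm z)\<^sup>2"
    by (simp only: z norm_prod_def power_mult_distrib) simp
  finally show "(norm (shear A z))\<^sup>2 \<le> (sqrt 2 * sqrt (1 + (onorm A)\<^sup>2) * norm z)\<^sup>2"
    by (simp add: z shear_def norm_prod_def)
qed simp

lemma subspace_shear_image:
  assumes "bounded_linear A" "subspace M"
  shows "subspace (shear A ` M)"
proof (rule linear_subspace_image[OF _ assms(2)])
  interpret A: bounded_linear A by fact
  show "linear (shear A)"
    by (rule linearI) (auto simp: shear_def A.add A.scaleR algebra_simps)
qed

text \<open>The shear by \<open>A\<close> is inverted by the shear by \<open>- A\<close>, so the
  image is a preimage under a continuous map.\<close>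

lemma closed_shear_image:
  assumes "bounded_linear A" "closed M"
  shows "closed (shear A ` M)"
proof -
  have "shear A ` M = shear (\<lambda>x. - A x) -` M"
    by (force simp: shear_def)
  moreover have "continuous_on UNIV (shear (\<lambda>x. - A x))"
    unfolding shear_def
    by (intro continuous_intros bounded_linear.continuous_on[OF assms(1)])
  ultimately show ?thesis using closed_vimage[OF assms(2)] by simp
qed

lemma norm_diff_orth_proj_shear_le:
  fixes M N :: "('a \<times> 'a::{real_inner, complete_space}) set"
  assumes M: "subspace M" "closed M" and N: "subspace N" "closed N"
    and A: "bounded_linear A" and B: "bounded_linear B"
    and z: "z \<in> shear A ` M"
  shows "norm (z - orth_proj inner (shear B ` N) z)
    \<le> 2 * sqrt 2 * sqrt (1 + (onorm A)\<^sup>2) * sqrt (1 + (onorm B)\<^sup>2) *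
       (onorm (\<lambda>z. orth_proj inner M z - orth_proj inner N z) + onorm (\<lambda>x. A x - B x)) * norm z"
proof -
  interpret A: bounded_linear A by fact
  interpret B: bounded_linear B by fact
  let ?P = "orth_proj inner M" and ?Q = "orth_proj inner N"
  define a where "a = sqrt (1 + (onorm A)\<^sup>2)"
  define b where "b = sqrt (1 + (onorm B)\<^sup>2)"
  define g where "g = onorm (\<lambda>z. ?P z - ?Q z)"
  define h where "h = onorm (\<lambda>x. A x - B x)"
  have a1: "1 \<le> a" and b1: "1 \<le> b" by (auto simp: a_def b_def)
  have PQ: "bounded_linear (\<lambda>z. ?P z - ?Q z)"
    by (intro bounded_linear_sub bounded_linear_orth_proj M N)
  have AB: "bounded_linear (\<lambda>x. A x - B x)" by (intro bounded_linear_sub A B)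
  have g0: "0 \<le> g" and h0: "0 \<le> h"
    using onorm_pos_le[OF PQ] onorm_pos_le[OF AB] by (auto simp: g_def h_def)
  obtain m where m: "m \<in> M" "z = shear A m" using z by blast
  have "?P m = m" using m by (intro orth_proj_eqI M) auto
  \<comment> \<open>As \<open>?P\<close> fixes \<open>m\<close>, the difference
    \<open>m - ?Q m\<close> is the value of P - Q at \<open>m\<close>.\<close>
  then have mQ: "norm (m - ?Q m) \<le> g * norm m" using onorm[OF PQ, of m] by (simp add: g_def)
  have "m = shear (\<lambda>x. - A x) z" using m by (simp add: shear_def)
  moreover have "bounded_linear (\<lambda>x. - A x)" "onorm (\<lambda>x. - A x) = onorm A"
    using bounded_linear_minus[OF A] onorm_neg[of A] by simp_all
  ultimately have mz: "norm m \<le> sqrt 2 * a * norm z"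
    using norm_shear_le[of "\<lambda>x. - A x" z] by (simp add: a_def)
  have fst_m: "norm (fst m) \<le> norm z"
    using m norm_fst_le[of "fst z" "snd z"] by (simp add: shear_def)
  \<comment> \<open>The competitor in the sheared \<open>N\<close> is the \<open>B\<close>-shear of
    the point of \<open>N\<close> nearest to \<open>m\<close>.\<close>
  have "norm (z - orth_proj inner (shear B ` N) z) \<le> norm (z - shear B (?Q m))"
    using orth_proj_mem[OF N]
    by (intro norm_diff_orth_proj_le subspace_shear_image closed_shear_image B N) auto
  also have "z - shear B (?Q m) = shear B (m - ?Q m) + (0, A (fst m) - B (fst m))"
    by (simp add: m shear_def B.diff prod_eq_iff)
  also have "norm \<dots> \<le> norm (shear B (m - ?Q m)) + norm (A (fst m) - B (fst m))"
    by (rule order_trans[OF norm_triangle_ineq]) (simp add: norm_Pair)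
  also have "\<dots> \<le> sqrt 2 * b * norm (m - ?Q m) + h * norm (fst m)"
    using norm_shear_le[OF B] onorm[OF AB, of "fst m"] by (intro add_mono) (auto simp: b_def h_def)
  also have "\<dots> \<le> sqrt 2 * b * (g * (sqrt 2 * a * norm z)) + h * norm z"
    using b1 g0 h0 fst_m by (intro add_mono mult_left_mono order_trans[OF mQ] mz) auto
  also have "\<dots> = 2 * a * b * g * norm z + 1 * h * norm z" by simp
  \<comment> \<open>The two shear estimates have contributed \<open>2 * a * b\<close> in front of
    \<open>g\<close>, while \<open>h\<close> has coefficient 1. Both coefficients are raised to the
    common value \<open>2 * sqrt 2 * a * b\<close>.\<close>
  also have "\<dots> \<le> 2 * sqrt 2 * a * b * g * norm z + 2 * sqrt 2 * a * b * h * norm z"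
  proof -
    have s: "1 \<le> sqrt (2::real)" by simp
    have "1 * 1 \<le> a * b" using a1 b1 by (intro mult_mono) auto
    moreover have "1 * (a * b) \<le> sqrt 2 * (a * b)" using s a1 b1 by (intro mult_right_mono) auto
    ultimately have "2 * a * b \<le> 2 * sqrt 2 * a * b" "1 \<le> 2 * sqrt 2 * a * b" by auto
    then show ?thesis using g0 h0 a1 b1 by (intro add_mono mult_right_mono) auto
  qed
  also have "\<dots> = 2 * sqrt 2 * a * b * (g + h) * norm z" by (simp add: algebra_simps)
  finally show ?thesis by (simp add: a_def b_def g_def h_def)
qed

section \<open>Closed operators\<close>

lemma closed_operators_graph:
  assumes T: "T \<in> closed_operators scaleR"
  shows "subspace (Map.graph T)" "closed (Map.graph T)"
proof -
  have graph: "(x, y) \<in> Map.graph T \<longleftrightarrow> x \<in> dom T \<and> the (T x) = y" for x y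
    by (auto simp: Map.graph_def)
  have dom: "0 \<in> dom T" "\<And>x y. x \<in> dom T \<Longrightarrow> y \<in> dom T \<Longrightarrow> x + y \<in> dom T"
    "\<And>c x. x \<in> dom T \<Longrightarrow> c *\<^sub>R x \<in> dom T"
    using T unfolding closed_operators_def module.subspace_def[OF real_vector.module_axioms] by auto
  have T': "\<And>x y. x \<in> dom T \<Longrightarrow> y \<in> dom T \<Longrightarrow> the (T (x + y)) = the (T x) + the (T y)"
    "\<And>c x. x \<in> dom T \<Longrightarrow> the (T (c *\<^sub>R x)) = c *\<^sub>R the (T x)"
    using T unfolding closed_operators_def by auto
  have "the (T 0) = 0" using T'(2)[OF dom(1), of 0] by simp
  then have "(0, 0) \<in> Map.graph T" by (simp add: graph dom)
  moreover have "(x + x', y + y') \<in> Map.graph T"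
    if "(x, y) \<in> Map.graph T" "(x', y') \<in> Map.graph T" for x x' y y'
    using that by (simp add: graph dom T')
  moreover have "(c *\<^sub>R x, c *\<^sub>R y) \<in> Map.graph T" if "(x, y) \<in> Map.graph T" for c x y
    using that by (simp add: graph dom T')
  ultimately show "subspace (Map.graph T)" by (auto simp: subspace_def zero_prod_def)
  show "closed (Map.graph T)" using T by (simp add: closed_operators_def)
qed

text \<open>\<open>A\<close> is defined everywhere, so the domain and its density are unchanged, and
  the new graph is closed as a shear image of a closed set. Keeping \<open>scl\<close> arbitrary
  covers both scalar fields.\<close>

lemma closed_operators_plus:
  assumes T: "T \<in> closed_operators scl" and A: "Vector_Spaces.linear scl scl A" "bounded_linear A"
  shows "operator_plus T A \<in> closed_operators scl"
proof -
  interpret A: Vector_Spaces.linear scl scl A by fact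
  have dom: "dom (operator_plus T A) = dom T"
    by (auto simp: operator_plus_def dom_def)
  have the: "the (operator_plus T A x) = the (T x) + A x" if "x \<in> dom T" for x
    using that by (auto simp: operator_plus_def)
  have sub: "\<And>x y. x \<in> dom T \<Longrightarrow> y \<in> dom T \<Longrightarrow> x + y \<in> dom T"
    "\<And>c x. x \<in> dom T \<Longrightarrow> scl c x \<in> dom T"
    using T unfolding closed_operators_def A.vs1.subspace_def by auto
  have "closed (Map.graph (operator_plus T A))"
    unfolding graph_operator_plus using T A(2)
    by (intro closed_shear_image) (auto simp: closed_operators_def)
  then show ?thesis
    using T unfolding closed_operators_def mem_Collect_eq dom
    by (auto simp: the sub A.add A.scale A.vs1.scale_right_distrib)
qed

lemma bounded_operators_bounded_linear:
  assumes "A \<in> bounded_operators scaleR"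
  shows "bounded_linear A"
proof -
  from assms obtain K where A: "Vector_Spaces.linear scaleR scaleR A"
    and K: "\<And>x. norm (A x) \<le> K * norm x"
    by (auto simp: bounded_operators_def)
  interpret A: Vector_Spaces.linear scaleR scaleR A by fact
  show ?thesis
    by (rule bounded_linear_intro[of _ K]) (auto simp: A.add A.scale K mult.commute)
qed

lemma gap_dist_plus_le:
  fixes T S :: "'a::{real_inner, complete_space} \<rightharpoonup> 'a"
  assumes T: "T \<in> closed_operators scaleR" and S: "S \<in> closed_operators scaleR"
    and A: "bounded_linear A" and B: "bounded_linear B"
  shows "gap_dist inner (operator_plus T A) (operator_plus S B)
    \<le> 2 * sqrt 2 * sqrt (1 + (onorm A)\<^sup>2) * sqrt (1 + (onorm B)\<^sup>2) *
       (gap_dist inner T S + onorm (\<lambda>x. A x - B x))"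
  unfolding gap_dist_def graph_operator_plus
proof (rule onorm_orth_proj_diff_le)
  note TS = closed_operators_graph[OF T] closed_operators_graph[OF S]
  show "0 \<le> 2 * sqrt 2 * sqrt (1 + (onorm A)\<^sup>2) * sqrt (1 + (onorm B)\<^sup>2) *
      (onorm (\<lambda>z. orth_proj inner (Map.graph T) z - orth_proj inner (Map.graph S) z) +
       onorm (\<lambda>x. A x - B x))"
    by (intro mult_nonneg_nonneg add_nonneg_nonneg onorm_pos_le bounded_linear_sub
        bounded_linear_orth_proj TS A B) auto
  fix z
  show "norm (z - orth_proj inner (shear B ` Map.graph S) z)
      \<le> 2 * sqrt 2 * sqrt (1 + (onorm A)\<^sup>2) * sqrt (1 + (onorm B)\<^sup>2) *
         (onorm (\<lambda>z. orth_proj inner (Map.graph T) z - orth_proj inner (Map.graph S) z) +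
          onorm (\<lambda>x. A x - B x)) * norm z" if "z \<in> shear A ` Map.graph T"
    by (rule norm_diff_orth_proj_shear_le[OF TS A B that])
  show "norm (z - orth_proj inner (shear A ` Map.graph T) z)
      \<le> 2 * sqrt 2 * sqrt (1 + (onorm A)\<^sup>2) * sqrt (1 + (onorm B)\<^sup>2) *
         (onorm (\<lambda>z. orth_proj inner (Map.graph T) z - orth_proj inner (Map.graph S) z) +
          onorm (\<lambda>x. A x - B x)) * norm z" if "z \<in> shear B ` Map.graph S"
    \<comment> \<open>Exchanging (T, A) with (S, B) gives the other one-sided estimate; the constant
      is symmetric under this exchange.\<close>
    using norm_diff_orth_proj_shear_le[OF TS(3,4,1,2) B A that]
    unfolding onorm_minus_commute[of B A]
      onorm_minus_commute[of "orth_proj inner (Map.graph S)" "orth_proj inner (Map.graph T)"]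
    by (simp only: mult_ac)
qed (auto intro!: subspace_shear_image closed_shear_image A B
    closed_operators_graph[OF T] closed_operators_graph[OF S])

section \<open>Reduction of the complex case to the real case\<close>

lemma cinner_scaleC_right: "cinner x (scaleC c y) = cnj c * cinner x y"
  by (metis cinner_commute cinner_scaleC_left complex_cnj_mult)

lemma orth_proj_cinner_eq_inner:
  fixes M :: "'a::complex_inner set"
  assumes "\<And>c x. x \<in> M \<Longrightarrow> scaleC c x \<in> M"
  shows "orth_proj cinner M = orth_proj inner M"
proof -
  have "(\<forall>m\<in>M. cinner x m = 0) \<longleftrightarrow> (\<forall>m\<in>M. inner x m = 0)" for x
  proof (intro iffI ballI)
    fix m assume *: "\<forall>m\<in>M. inner x m = 0" and m: "m \<in> M"
    \<comment> \<open>the imaginary part of \<open>cinner x m\<close> is the real part of \<open>cinner x (\<i> m)\<close>\<close>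
    have "Re (cinner x m) = 0" "Re (cinner x (scaleC \<i> m)) = 0"
      using * m assms[OF m] by (auto simp flip: inner_cinner)
    then show "cinner x m = 0" by (simp add: cinner_scaleC_right complex_eq_iff)
  qed (simp add: inner_cinner)
  \<comment> \<open>The predicates under the two definite descriptions agree, hence so do their
    values, whether or not a unique witness exists.\<close>
  then show ?thesis by (simp add: orth_proj_def fun_eq_iff)
qed

lemma closed_operators_scaleC_scaleR:
  assumes "T \<in> closed_operators scaleC"
  shows "T \<in> closed_operators scaleR"
proof -
  interpret C: vector_space "scaleC :: complex \<Rightarrow> 'a \<Rightarrow> 'a" by (rule vector_space_scaleC)
  show ?thesis
    using assms by (auto simp: closed_operators_def C.subspace_def scaleR_scaleC
        module.subspace_def[OF real_vector.module_axioms])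
qed

lemma bounded_operators_scaleC_scaleR:
  assumes "A \<in> bounded_operators scaleC"
  shows "A \<in> bounded_operators scaleR"
proof -
  from assms interpret A: Vector_Spaces.linear scaleC scaleC A by (simp add: bounded_operators_def)
  have "Vector_Spaces.linear scaleR scaleR A"
    by unfold_locales (auto simp: algebra_simps A.add scaleR_scaleC A.scale)
  then show ?thesis using assms by (simp add: bounded_operators_def)
qed

text \<open>Complex homogeneity makes each graph stable under complex scalars, so real and complex
  orthogonality to it coincide.\<close>

lemma gap_dist_cinner_eq_inner:
  assumes "T \<in> closed_operators scaleC" "S \<in> closed_operators scaleC"
  shows "gap_dist cinner T S = gap_dist inner T S"
proof -
  interpret C: vector_space "scaleC :: complex \<Rightarrow> 'a \<Rightarrow> 'a" by (rule vector_space_scaleC)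
  have "orth_proj cinner (Map.graph R) = orth_proj inner (Map.graph R)"
    if R: "R \<in> closed_operators scaleC" for R :: "'a \<rightharpoonup> 'a"
  proof (rule orth_proj_cinner_eq_inner)
    fix c and z :: "'a \<times> 'a" assume "z \<in> Map.graph R"
    then have "fst z \<in> dom R" "the (R (fst z)) = snd z" by (auto simp: Map.graph_def)
    with R have "scaleC c (fst z) \<in> dom R" "the (R (scaleC c (fst z))) = scaleC c (snd z)"
      by (auto simp: closed_operators_def C.subspace_def)
    then show "scaleC c z \<in> Map.graph R" by (auto simp: Map.graph_def scaleC_prod_def)
  qed
  then show ?thesis using assms by (simp add: gap_dist_def)
qed

theorem theorem3p7:
  shows
    "(separable_space (euclidean :: 'a::{real_inner, complete_space} topology) \<longrightarrow>
      (\<forall>T \<in> closed_operators (scaleR :: real \<Rightarrow> 'a \<Rightarrow> 'a).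
       \<forall>S \<in> closed_operators (scaleR :: real \<Rightarrow> 'a \<Rightarrow> 'a).
       \<forall>A \<in> bounded_operators (scaleR :: real \<Rightarrow> 'a \<Rightarrow> 'a).
       \<forall>B \<in> bounded_operators (scaleR :: real \<Rightarrow> 'a \<Rightarrow> 'a).
         operator_plus T A \<in> closed_operators scaleR \<and>
         operator_plus S B \<in> closed_operators scaleR \<and>
         gap_dist inner (operator_plus T A) (operator_plus S B)
           \<le> 2 * sqrt 2 * sqrt (1 + (onorm A)\<^sup>2) * sqrt (1 + (onorm B)\<^sup>2) *
              (gap_dist inner T S + onorm (\<lambda>x. A x - B x))))
     \<and>
     (separable_space (euclidean :: 'b::{complex_inner, complete_space} topology) \<longrightarrow>
      (\<forall>T \<in> closed_operators (scaleC :: complex \<Rightarrow> 'b \<Rightarrow> 'b).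
       \<forall>S \<in> closed_operators (scaleC :: complex \<Rightarrow> 'b \<Rightarrow> 'b).
       \<forall>A \<in> bounded_operators (scaleC :: complex \<Rightarrow> 'b \<Rightarrow> 'b).
       \<forall>B \<in> bounded_operators (scaleC :: complex \<Rightarrow> 'b \<Rightarrow> 'b).
         operator_plus T A \<in> closed_operators scaleC \<and>
         operator_plus S B \<in> closed_operators scaleC \<and>
         gap_dist cinner (operator_plus T A) (operator_plus S B)
           \<le> 2 * sqrt 2 * sqrt (1 + (onorm A)\<^sup>2) * sqrt (1 + (onorm B)\<^sup>2) *
              (gap_dist cinner T S + onorm (\<lambda>x. A x - B x))))"
proof (intro conjI impI ballI)
  fix T S :: "'a \<rightharpoonup> 'a" and A B :: "'a \<Rightarrow> 'a"
  assume T: "T \<in> closed_operators scaleR" and S: "S \<in> closed_operators scaleR"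
    and A: "A \<in> bounded_operators scaleR" and B: "B \<in> bounded_operators scaleR"
  note bl = A[THEN bounded_operators_bounded_linear] B[THEN bounded_operators_bounded_linear]
  show "operator_plus T A \<in> closed_operators scaleR" "operator_plus S B \<in> closed_operators scaleR"
    using A B by (auto intro!: closed_operators_plus T S bl simp: bounded_operators_def)
  show "gap_dist inner (operator_plus T A) (operator_plus S B)
      \<le> 2 * sqrt 2 * sqrt (1 + (onorm A)\<^sup>2) * sqrt (1 + (onorm B)\<^sup>2) *
         (gap_dist inner T S + onorm (\<lambda>x. A x - B x))"
    by (rule gap_dist_plus_le[OF T S bl])
next
  fix T S :: "'b \<rightharpoonup> 'b" and A B :: "'b \<Rightarrow> 'b"
  assume T: "T \<in> closed_operators scaleC" and S: "S \<in> closed_operators scaleC"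
    and A: "A \<in> bounded_operators scaleC" and B: "B \<in> bounded_operators scaleC"
  note bl = A[THEN bounded_operators_scaleC_scaleR, THEN bounded_operators_bounded_linear]
    B[THEN bounded_operators_scaleC_scaleR, THEN bounded_operators_bounded_linear]
  show TA: "operator_plus T A \<in> closed_operators scaleC"
    and SB: "operator_plus S B \<in> closed_operators scaleC"
    using A B by (auto intro!: closed_operators_plus T S bl simp: bounded_operators_def)
  \<comment> \<open>\<open>TA\<close> and \<open>SB\<close> allow the left-hand gap to be turned
    into a real one, like the gap of \<open>T\<close> and \<open>S\<close>; the real estimate then
    applies verbatim.\<close>
  show "gap_dist cinner (operator_plus T A) (operator_plus S B)
      \<le> 2 * sqrt 2 * sqrt (1 + (onorm A)\<^sup>2) * sqrt (1 + (onorm B)\<^sup>2) *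
         (gap_dist cinner T S + onorm (\<lambda>x. A x - B x))"
    unfolding gap_dist_cinner_eq_inner[OF T S] gap_dist_cinner_eq_inner[OF TA SB]
    by (rule gap_dist_plus_le[OF T[THEN closed_operators_scaleC_scaleR]
          S[THEN closed_operators_scaleC_scaleR] bl])
qed

end
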